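(* Let $(C,\star)$ be a conjugation quandle over a group $G$. Then the following are equivalent: (1) the quandle $(C,\star)$ is connected; (2) $C$ is a conjugacy class of the group $\langle C\rangle$.
   Context: A quandle is a nonempty set $Q$ with a binary operation $\star$ such that for each $a\in Q$ one has $a\star a=a$ and the left translation $L_a:Q\to Q$, $x\mapsto a\star x$, is an automorphism of $(Q,\star)$. It is connected if the group $\langle L_a\mid a\in Q\rangle\leq S_Q$ (where $S_Q$ is the symmetric group on $Q$) acts transitively on $Q$. A conjugation quandle over a group $G$ is a quandle $(C,\star)$ with $C\subseteq G$ and $a\star b=aba^{-1}$ for all $a,b\in C$. $\langle C\rangle$ denotes the subgroup of $G$ generated by $C$. *)

theory Defs
  imports "HOL-Algebra.Algebra"
begin

text \<open>Self-maps of \<open>Q\<close> are taken extensional, so that they are elements of the library's symmetric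
  group \<^const>\<open>BijGroup\<close>.\<close>

definition binop_automorphisms :: "'a set \<Rightarrow> ('a \<Rightarrow> 'a \<Rightarrow> 'a) \<Rightarrow> ('a \<Rightarrow> 'a) set"
  where "binop_automorphisms Q op =
    {f \<in> Bij Q. \<forall>x\<in>Q. \<forall>y\<in>Q. f (op x y) = op (f x) (f y)}"

definition left_translation :: "'a set \<Rightarrow> ('a \<Rightarrow> 'a \<Rightarrow> 'a) \<Rightarrow> 'a \<Rightarrow> 'a \<Rightarrow> 'a"
  where "left_translation Q op a = (\<lambda>x\<in>Q. op a x)"

locale quandle =
  fixes Q :: "'a set" and star :: "'a \<Rightarrow> 'a \<Rightarrow> 'a" (infixl "\<star>" 70)
  assumes nonempty: "Q \<noteq> {}"
    and closed: "\<lbrakk>a \<in> Q; b \<in> Q\<rbrakk> \<Longrightarrow> a \<star> b \<in> Q"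
    and idem: "a \<in> Q \<Longrightarrow> a \<star> a = a"
    and left_translation_automorphism:
      "a \<in> Q \<Longrightarrow> left_translation Q (\<star>) a \<in> binop_automorphisms Q (\<star>)"

definition left_translation_group :: "'a set \<Rightarrow> ('a \<Rightarrow> 'a \<Rightarrow> 'a) \<Rightarrow> ('a \<Rightarrow> 'a) monoid"
  where "left_translation_group Q op =
    subgroup_generated (BijGroup Q) (left_translation Q op ` Q)"

locale connected_quandle = quandle +
  assumes transitive: "transitive_action (left_translation_group Q (\<star>)) Q (\<lambda>f. f)"

locale conjugation_quandle = group G + quandle C star
  for G (structure) and C and star (infixl "\<star>" 70) +
  assumes subset_carrier: "C \<subseteq> carrier G"
    and star_eq: "\<lbrakk>a \<in> C; b \<in> C\<rbrakk> \<Longrightarrow> a \<star> b = a \<otimes> b \<otimes> inv a"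

definition conjugacy_classes :: "('a, 'b) monoid_scheme \<Rightarrow> 'a set set"
  where "conjugacy_classes H =
    orbits H (carrier H) (\<lambda>g. \<lambda>h\<in>carrier H. g \<otimes>\<^bsub>H\<^esub> h \<otimes>\<^bsub>H\<^esub> inv\<^bsub>H\<^esub> g)"

end

theory Submission
  imports Defs
begin

text \<open>The left translation by \<open>a\<close> is conjugation by \<open>a\<close> restricted to \<open>C\<close>. It maps \<open>C\<close> onto \<open>C\<close>,
  hence so does conjugation by any element of \<open>\<langle>C\<rangle>\<close>. Thus \<open>\<langle>C\<rangle>\<close> acts on \<open>C\<close> by conjugation, and the
  group generated by the left translations is the image of this action. Both conditions therefore
  say that any two elements of \<open>C\<close> are conjugate under \<open>\<langle>C\<rangle>\<close>.\<close>

context group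
begin

lemma conjugation_mult:
  assumes "g \<in> carrier G" "h \<in> carrier G" "x \<in> carrier G"
  shows "(g \<otimes> h) \<otimes> x \<otimes> inv (g \<otimes> h) = g \<otimes> (h \<otimes> x \<otimes> inv h) \<otimes> inv g"
  using assms by (simp add: inv_mult_group m_assoc)

lemma conjugation_inv_cancel:
  assumes "g \<in> carrier G" "x \<in> carrier G"
  shows "inv g \<otimes> (g \<otimes> x \<otimes> inv g) \<otimes> g = x"
  using conjugation_mult[of "inv g" g x] assms by simp

lemma inj_on_conjugation:
  assumes "g \<in> carrier G" "A \<subseteq> carrier G"
  shows "inj_on (\<lambda>x. g \<otimes> x \<otimes> inv g) A"
  by (rule inj_on_inverseI[where g = "\<lambda>y. inv g \<otimes> y \<otimes> g"])
    (use assms conjugation_inv_cancel in blast)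

text \<open>The elements that conjugate \<open>A\<close> onto itself form a subgroup, the normalizer
  of \<open>A\<close>, so it contains \<open>generate G S\<close> as soon as it contains
  \<open>S\<close>.\<close>

lemma generate_conjugation_image:
  assumes A: "A \<subseteq> carrier G" and S: "S \<subseteq> carrier G"
    and gen: "\<And>a. a \<in> S \<Longrightarrow> (\<lambda>x. a \<otimes> x \<otimes> inv a) ` A = A"
    and "g \<in> generate G S"
  shows "(\<lambda>x. g \<otimes> x \<otimes> inv g) ` A = A"
  using \<open>g \<in> generate G S\<close>
proof induction
  case one
  have "(\<lambda>x. \<one> \<otimes> x \<otimes> inv \<one>) ` A = (\<lambda>x. x) ` A"
    using A by (intro image_cong) auto
  then show ?case by simp
next
  case (incl a)
  then show ?case by (rule gen)
next
  case (inv a)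
  then have a: "a \<in> carrier G" using S by blast
  \<comment> \<open>Here the equality in \<open>gen\<close> matters: for infinite \<open>A\<close>,
    a mere inclusion of the image in \<open>A\<close> would not pass to
    \<open>inv a\<close>.\<close>
  have "(\<lambda>x. inv a \<otimes> x \<otimes> inv (inv a)) ` (\<lambda>x. a \<otimes> x \<otimes> inv a) ` A = (\<lambda>x. x) ` A"
    unfolding image_image using A a by (intro image_cong) (auto simp: conjugation_inv_cancel)
  then show ?case using gen[OF inv] by simp
next
  case (eng g h)
  then have gh: "g \<in> carrier G" "h \<in> carrier G"
    using generate_in_carrier[OF S] by auto
  have "(\<lambda>x. (g \<otimes> h) \<otimes> x \<otimes> inv (g \<otimes> h)) ` A
      = (\<lambda>x. g \<otimes> x \<otimes> inv g) ` (\<lambda>x. h \<otimes> x \<otimes> inv h) ` A"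
    unfolding image_image using A gh by (intro image_cong) (auto intro!: conjugation_mult)
  then show ?case using eng.IH by simp
qed

end

text \<open>\<open>transitive_action\<close> includes \<open>group_action\<close>; with this part
  settled, connectedness reduces to the existence of a map taking \<open>x\<close> to
  \<open>y\<close>.\<close>

lemma group_action_subgroup_generated_BijGroup:
  "group_action (subgroup_generated (BijGroup E) S) E (\<lambda>f. f)"
proof -
  interpret B: group "BijGroup E" by (rule group_BijGroup)
  have "(\<lambda>f. f) \<in> hom (BijGroup E) (BijGroup E)"
    by (simp add: hom_def)
  then show ?thesis
    by (simp add: group_action_def group_hom_def group_hom_axioms_def
        B.hom_from_subgroup_generated B.is_group)
qed

context conjugation_quandle
begin

lemma left_translation_eq:
  "a \<in> C \<Longrightarrow> left_translation C (\<star>) a = (\<lambda>x\<in>C. a \<otimes> x \<otimes> inv a)"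
  by (auto simp: left_translation_def star_eq)

lemma carrier_generated: "carrier (subgroup_generated G C) = generate G C"
  using subset_carrier by (simp add: carrier_subgroup_generated Int_absorb1)

lemma conjugation_image:
  assumes "g \<in> carrier (subgroup_generated G C)"
  shows "(\<lambda>x. g \<otimes> x \<otimes> inv g) ` C = C"
proof (rule generate_conjugation_image[OF subset_carrier subset_carrier])
  fix a assume a: "a \<in> C"
  have "left_translation C (\<star>) a ` C = C"
    using left_translation_automorphism[OF a]
    by (simp add: binop_automorphisms_def Bij_def bij_betw_def)
  then show "(\<lambda>x. a \<otimes> x \<otimes> inv a) ` C = C"
    using a by (simp add: left_translation_eq)
qed (use assms in \<open>simp add: carrier_generated\<close>)

lemma conjugation_group_hom:
  "group_hom (subgroup_generated G C) (BijGroup C) (\<lambda>g. \<lambda>x\<in>C. g \<otimes> x \<otimes> inv g)"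
proof -
  let ?H = "subgroup_generated G C" and ?c = "\<lambda>g. \<lambda>x\<in>C. g \<otimes> x \<otimes> inv g"
  have G: "g \<in> carrier G" if "g \<in> carrier ?H" for g
    using that carrier_subgroup_generated_subset by blast
  have bij: "?c g \<in> Bij C" if "g \<in> carrier ?H" for g
    using conjugation_image[OF that] inj_on_conjugation[OF G[OF that] subset_carrier]
    by (simp add: Bij_def bij_betw_def inj_on_restrict_eq)
  have "?c (g \<otimes> h) = compose C (?c g) (?c h)" if gh: "g \<in> carrier ?H" "h \<in> carrier ?H" for g h
  proof
    fix x
    show "?c (g \<otimes> h) x = compose C (?c g) (?c h) x"
    proof (cases "x \<in> C")
      case True
      \<comment> \<open>The outer map is restricted to \<open>C\<close>, so it acts as conjugation
        only if the inner value lies in \<open>C\<close>.\<close>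
      then have "h \<otimes> x \<otimes> inv h \<in> C"
        using conjugation_image[OF gh(2)] by blast
      then show ?thesis
        using True subset_carrier gh by (auto simp: compose_def G conjugation_mult)
    qed (simp add: compose_def)
  qed
  then have "?c \<in> hom ?H (BijGroup C)"
    using bij by (auto simp: hom_def BijGroup_def)
  then show ?thesis
    by (simp add: group_hom_def group_hom_axioms_def group_BijGroup)
qed

text \<open>A homomorphism maps the subgroup generated by a set onto the subgroup generated by the
  image of that set, and the left translations are the images of the elements of
  \<open>C\<close>.\<close>

lemma carrier_left_translation_group:
  "carrier (left_translation_group C (\<star>))
    = (\<lambda>g. \<lambda>x\<in>C. g \<otimes> x \<otimes> inv g) ` carrier (subgroup_generated G C)"
proof -
  have "left_translation C (\<star>) ` C = (\<lambda>g. \<lambda>x\<in>C. g \<otimes> x \<otimes> inv g) ` C"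
    by (intro image_cong refl left_translation_eq)
  then show ?thesis
    \<comment> \<open>The domain is already generated by \<open>C\<close>; generating by
      \<open>C\<close> once more inside it changes nothing.\<close>
    using group_hom.subgroup_generated_by_image[OF conjugation_group_hom
        subgroup_generated_subset_carrier_subset[OF subset_carrier]]
    by (simp add: left_translation_group_def)
qed

lemma connected_iff:
  "connected_quandle C (\<star>) \<longleftrightarrow>
    (\<forall>x\<in>C. \<forall>y\<in>C. \<exists>g\<in>carrier (subgroup_generated G C). g \<otimes> x \<otimes> inv g = y)"
proof -
  have "connected_quandle C (\<star>) \<longleftrightarrow>
      (\<forall>x\<in>C. \<forall>y\<in>C. \<exists>f\<in>carrier (left_translation_group C (\<star>)). f x = y)"
    using quandle_axioms group_action_subgroup_generated_BijGroup
    unfolding connected_quandle_def connected_quandle_axioms_def transitive_action_def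
      transitive_action_axioms_def left_translation_group_def by blast
  then show ?thesis
    by (simp add: carrier_left_translation_group)
qed

text \<open>The right-hand side puts \<open>C\<close> inside a single class; as \<open>C\<close> is
  nonempty and stable under conjugation by its generated subgroup, it is then the whole
  class.\<close>

lemma mem_conjugacy_classes_iff:
  "C \<in> conjugacy_classes (subgroup_generated G C) \<longleftrightarrow>
    (\<forall>x\<in>C. \<forall>y\<in>C. \<exists>g\<in>carrier (subgroup_generated G C). g \<otimes> x \<otimes> inv g = y)"
proof -
  let ?H = "subgroup_generated G C"
  let ?k = "\<lambda>g. \<lambda>h\<in>carrier ?H. g \<otimes>\<^bsub>?H\<^esub> h \<otimes>\<^bsub>?H\<^esub> inv\<^bsub>?H\<^esub> g"
  interpret H: group_action ?H "carrier ?H" ?k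
    by (rule group.action_by_conjugation) simp
  have CH: "C \<subseteq> carrier ?H"
    by (rule subgroup_generated_subset_carrier_subset[OF subset_carrier])
  \<comment> \<open>Inverses in \<open>?H\<close> and in \<open>G\<close> agree only on elements of
    \<open>?H\<close>, hence the congruence rule that supplies the membership of
    \<open>g\<close>.\<close>
  have orbit: "orbit ?H ?k x = {g \<otimes> x \<otimes> inv g | g. g \<in> carrier ?H}"
    if "x \<in> carrier ?H" for x
    unfolding orbit_def using that by (intro Collect_cong ex_cong1) (auto cong: conj_cong)
  show ?thesis
  proof
    assume "C \<in> conjugacy_classes ?H"
    then obtain z where z: "z \<in> carrier ?H" "C = orbit ?H ?k z"
      by (auto simp: conjugacy_classes_def orbits_def)
    show "\<forall>x\<in>C. \<forall>y\<in>C. \<exists>g\<in>carrier ?H. g \<otimes> x \<otimes> inv g = y"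
    proof (intro ballI)
      fix x y assume xy: "x \<in> C" "y \<in> C"
      with CH have xy_H: "x \<in> carrier ?H" "y \<in> carrier ?H" by auto
      \<comment> \<open>The class comes with some representative \<open>z\<close>; the path from
        \<open>x\<close> to \<open>y\<close> runs through it.\<close>
      have "z \<in> orbit ?H ?k x"
        by (rule H.orbit_sym[OF z(1) xy_H(1)]) (use xy z(2) in blast)
      then have "y \<in> orbit ?H ?k x"
        by (rule H.orbit_trans[OF xy_H(1) z(1) xy_H(2)]) (use xy z(2) in blast)
      then show "\<exists>g\<in>carrier ?H. g \<otimes> x \<otimes> inv g = y"
        unfolding orbit[OF xy_H(1)] by blast
    qed
  next
    assume trans: "\<forall>x\<in>C. \<forall>y\<in>C. \<exists>g\<in>carrier ?H. g \<otimes> x \<otimes> inv g = y"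
    obtain x where x: "x \<in> C" using nonempty by blast
    have "C = {g \<otimes> x \<otimes> inv g | g. g \<in> carrier ?H}"
    proof
      show "C \<subseteq> {g \<otimes> x \<otimes> inv g | g. g \<in> carrier ?H}"
      proof
        fix y assume "y \<in> C"
        then obtain g where "g \<in> carrier ?H" "g \<otimes> x \<otimes> inv g = y"
          using trans x by meson
        then show "y \<in> {g \<otimes> x \<otimes> inv g | g. g \<in> carrier ?H}" by blast
      qed
      \<comment> \<open>This inclusion comes from the quandle structure, not from
        \<open>trans\<close>.\<close>
      show "{g \<otimes> x \<otimes> inv g | g. g \<in> carrier ?H} \<subseteq> C"
      proof clarify
        fix g assume "g \<in> carrier ?H"
        from conjugation_image[OF this] x show "g \<otimes> x \<otimes> inv g \<in> C" by blast
      qed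
    qed
    also have "\<dots> = orbit ?H ?k x"
      using orbit[OF subsetD[OF CH x]] by (rule sym)
    finally have "C = orbit ?H ?k x" .
    then show "C \<in> conjugacy_classes ?H"
      unfolding conjugacy_classes_def orbits_def using subsetD[OF CH x] by (intro CollectI exI conjI)
  qed
qed

end

theorem theorem3p2:
  fixes G :: "('a, 'b) monoid_scheme" and C :: "'a set" and star :: "'a \<Rightarrow> 'a \<Rightarrow> 'a"
  assumes "conjugation_quandle G C star"
  shows "connected_quandle C star \<longleftrightarrow> C \<in> conjugacy_classes (subgroup_generated G C)"
  using conjugation_quandle.connected_iff[OF assms]
    conjugation_quandle.mem_conjugacy_classes_iff[OF assms] by simp

end
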